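(* Let $G$ be a directed graph on $V=\{s,t\}\cup\mathcal{V}$ with non-negative capacities $c_{uv}$, and let $\mathcal{V}_1,\mathcal{V}_2\subseteq\mathcal{V}$ with $\mathcal{V}_1\cup\mathcal{V}_2=\mathcal{V}$, $\mathcal{V}_1\cap\mathcal{V}_2\ne\varnothing$, such that every edge $(i,j)$ with $i,j\in\mathcal{V}$ and $c_{ij}>0$ has both endpoints in $\mathcal{V}_1$ or both in $\mathcal{V}_2$. Run the following procedure for $K\ge1$ iterations. Splitting: $G_r^{(1)}$ ($r=1,2$) is the graph on $\{s,t\}\cup\mathcal{V}_r$ whose capacity on $(u,v)$ is $\tfrac12c_{uv}$ if $u,v\in\{s,t\}\cup(\mathcal{V}_1\cap\mathcal{V}_2)$ and $c_{uv}$ otherwise. Iteration $m=1,\dots,K$: (a) on each $G_r^{(m)}$ an augmenting path maxflow computation pushes a total flow $\mathrm{F}_r^{(m)}$ from $s$ to $t$ (each push along a path decreases forward arc capacities and increases the corresponding backward arc capacities by the pushed amount), giving the residual graph $G_r^{(m')}$; (b) given dual variables $\boldsymbol\lambda^{(m)},\boldsymbol\lambda^{(m+1)}\in\mathbb{R}^{\mathcal{V}_1\cap\mathcal{V}_2}$ and $\triangle\lambda_i^{(m+1)}=\lambda_i^{(m+1)}-\lambda_i^{(m)}$, $G_1^{(m+1)}$ is obtained from $G_1^{(m')}$ by increasing the capacity of $(s,i)$ by $\triangle\lambda_i^{(m+1)}$ for each $i\in\mathcal{V}_1\cap\mathcal{V}_2$, and $G_2^{(m+1)}$ is obtained from $G_2^{(m')}$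 by increasing the capacity of $(i,t)$ by $\triangle\lambda_i^{(m+1)}$ for each $i\in\mathcal{V}_1\cap\mathcal{V}_2$. Merging: $G'$ is the graph on $\{s,t\}\cup\mathcal{V}$ in which an edge with both endpoints in $\{s,t\}\cup(\mathcal{V}_1\cap\mathcal{V}_2)$ has capacity equal to the sum of its capacities in $G_1^{(K+1)}$ and $G_2^{(K+1)}$, and every other edge has its capacity from the one of $G_1^{(K+1)},G_2^{(K+1)}$ containing it. Then for all $\mathbf{x}_\mathcal{V}$, $$f^{G}(\mathbf{x}_\mathcal{V})=f^{G'}(\mathbf{x}_\mathcal{V})+\sum_{m=1}^{K}\mathrm{F}_1^{(m)}+\sum_{m=1}^{K}\mathrm{F}_2^{(m)},$$ i.e. $f^{G'}$ and $f^G$ differ only in their constant terms, by the total flow pushed in the two subgraphs over the $K$ iterations.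
   Context: For a directed graph $H$ on $\{s,t\}\cup W$ with capacities $c_{uv}$ (absent edges have capacity $0$), its restricted homogeneous posiform is $\phi^H_h(\mathbf{x}_W)=\sum_{i\in W}c_{si}x_i+\sum_{i\in W}c_{it}(1-x_i)+\sum_{i\ne j\in W}c_{ij}(1-x_i)x_j$ for $\mathbf{x}_W\in\{0,1\}^W$, which gives the $s$-$t$ cut cost (up to an $\mathbf{x}$-independent constant) with $x_i=0$ meaning $i$ is on the source side. The multi-linear polynomial $f^H$ of $H$ is the unique polynomial $l+\sum_{i}l_ix_i+\sum_{\{i,j\},\,i\ne j}l_{ij}x_ix_j$ agreeing with $\phi^H_h$ on $\{0,1\}^W$.
   Formalization: The displayed identity fails in general; the proved one also subtracts Σ_i(λ_i^(K+1)−λ_i^(1)) over V_1∩V_2 and c_st−c'_st (c' = capacity in G'). The displayed form is obtained when c_st=0 and Σ_iλ_i^(K+1)=Σ_iλ_i^(1). *)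

theory Defs
  imports Complex_Main
begin

text \<open>
  A graph on the vertices \<open>{s, t} \<union> W\<close> is given by \<open>s\<close>, \<open>t\<close>, \<open>W\<close> and its capacities
  \<open>c u v\<close>, with capacity \<open>0\<close> for absent edges. Capacities of arbitrary sign are allowed, since the
  updates of the dual variables may make a capacity negative.
\<close>

type_synonym 'a capacity = "'a \<Rightarrow> 'a \<Rightarrow> real"

text \<open>The capacity \<open>c s t\<close> does not occur: it contributes only a constant to the cost of a cut.\<close>

definition posiform :: "'a \<Rightarrow> 'a \<Rightarrow> 'a set \<Rightarrow> 'a capacity \<Rightarrow> ('a \<Rightarrow> real) \<Rightarrow> real" where
  "posiform s t W c x =
     (\<Sum>i\<in>W. c s i * x i) + (\<Sum>i\<in>W. c i t * (1 - x i))
     + (\<Sum>i\<in>W. \<Sum>j\<in>W - {i}. c i j * (1 - x i) * x j)"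

text \<open>The coefficient of \<open>x\<^sub>i x\<^sub>j\<close> is \<open>mlp_quad p {i, j}\<close>.\<close>

datatype 'a mlp = MLP (mlp_const: real) (mlp_lin: "'a \<Rightarrow> real") (mlp_quad: "'a set \<Rightarrow> real")

definition pairs :: "'a set \<Rightarrow> 'a set set" where
  "pairs W = {e. e \<subseteq> W \<and> card e = 2}"

definition mlp_eval :: "'a set \<Rightarrow> 'a mlp \<Rightarrow> ('a \<Rightarrow> real) \<Rightarrow> real" where
  "mlp_eval W p x =
     mlp_const p + (\<Sum>i\<in>W. mlp_lin p i * x i) + (\<Sum>e\<in>pairs W. mlp_quad p e * (\<Prod>i\<in>e. x i))"

definition mlp_in :: "'a set \<Rightarrow> 'a mlp \<Rightarrow> bool" where
  "mlp_in W p \<longleftrightarrow> (\<forall>i. i \<notin> W \<longrightarrow> mlp_lin p i = 0) \<and> (\<forall>e. e \<notin> pairs W \<longrightarrow> mlp_quad p e = 0)"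

definition mlp_of_graph :: "'a \<Rightarrow> 'a \<Rightarrow> 'a set \<Rightarrow> 'a capacity \<Rightarrow> 'a mlp" where
  "mlp_of_graph s t W c =
     (THE p. mlp_in W p \<and>
        (\<forall>x. (\<forall>i\<in>W. x i \<in> {0, 1}) \<longrightarrow> mlp_eval W p x = posiform s t W c x))"

definition arcs :: "'a list \<Rightarrow> ('a \<times> 'a) set" where
  "arcs p = set (zip p (tl p))"

definition st_path :: "'a \<Rightarrow> 'a \<Rightarrow> 'a set \<Rightarrow> 'a list \<Rightarrow> bool" where
  "st_path s t W p \<longleftrightarrow>
     p \<noteq> [] \<and> hd p = s \<and> last p = t \<and> distinct p \<and> set p \<subseteq> {s, t} \<union> W"

definition augmenting :: "'a \<Rightarrow> 'a \<Rightarrow> 'a set \<Rightarrow> 'a capacity \<Rightarrow> 'a list \<Rightarrow> real \<Rightarrow> bool" where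
  "augmenting s t W c p d \<longleftrightarrow> st_path s t W p \<and> 0 < d \<and> (\<forall>(u, v)\<in>arcs p. d \<le> c u v)"

definition push :: "'a capacity \<Rightarrow> 'a list \<Rightarrow> real \<Rightarrow> 'a capacity" where
  "push c p d = (\<lambda>u v. c u v - (if (u, v) \<in> arcs p then d else 0)
                            + (if (v, u) \<in> arcs p then d else 0))"

text \<open>
  \<open>pushes s t W c F c'\<close>: finitely many pushes along augmenting paths, of total amount \<open>F\<close>,
  turn the capacities \<open>c\<close> into the residual capacities \<open>c'\<close>.
\<close>

inductive pushes :: "'a \<Rightarrow> 'a \<Rightarrow> 'a set \<Rightarrow> 'a capacity \<Rightarrow> real \<Rightarrow> 'a capacity \<Rightarrow> bool"
  for s t W c where
  pushes_none: "pushes s t W c 0 c"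
| pushes_step: "pushes s t W c F c' \<Longrightarrow> augmenting s t W c' p d
                \<Longrightarrow> pushes s t W c (F + d) (push c' p d)"

definition maxflow_run :: "'a \<Rightarrow> 'a \<Rightarrow> 'a set \<Rightarrow> 'a capacity \<Rightarrow> real \<Rightarrow> 'a capacity \<Rightarrow> bool" where
  "maxflow_run s t W c F c' \<longleftrightarrow>
     pushes s t W c F c' \<and> \<not> (\<exists>p d. augmenting s t W c' p d)"

text \<open>
  In the following, \<open>I\<close> is the common part of the two inner vertex sets and \<open>W\<close> is one of
  these sets.
\<close>

definition split_cap :: "'a \<Rightarrow> 'a \<Rightarrow> 'a set \<Rightarrow> 'a set \<Rightarrow> 'a capacity \<Rightarrow> 'a capacity" where
  "split_cap s t I W c = (\<lambda>u v.
     if u \<in> {s, t} \<union> I \<and> v \<in> {s, t} \<union> I then c u v / 2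
     else if u \<in> {s, t} \<union> W \<and> v \<in> {s, t} \<union> W then c u v
     else 0)"

definition raise_source :: "'a \<Rightarrow> 'a set \<Rightarrow> ('a \<Rightarrow> real) \<Rightarrow> 'a capacity \<Rightarrow> 'a capacity" where
  "raise_source s I \<delta> c = (\<lambda>u v. if u = s \<and> v \<in> I then c u v + \<delta> v else c u v)"

definition raise_sink :: "'a \<Rightarrow> 'a set \<Rightarrow> ('a \<Rightarrow> real) \<Rightarrow> 'a capacity \<Rightarrow> 'a capacity" where
  "raise_sink t I \<delta> c = (\<lambda>u v. if u \<in> I \<and> v = t then c u v + \<delta> u else c u v)"

definition merge_cap ::
  "'a \<Rightarrow> 'a \<Rightarrow> 'a set \<Rightarrow> 'a set \<Rightarrow> 'a capacity \<Rightarrow> 'a capacity \<Rightarrow> 'a capacity" where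
  "merge_cap s t V1 V2 c1 c2 = (\<lambda>u v.
     if u \<in> {s, t} \<union> (V1 \<inter> V2) \<and> v \<in> {s, t} \<union> (V1 \<inter> V2) then c1 u v + c2 u v
     else if u \<in> {s, t} \<union> V1 \<and> v \<in> {s, t} \<union> V1 then c1 u v
     else if u \<in> {s, t} \<union> V2 \<and> v \<in> {s, t} \<union> V2 then c2 u v
     else 0)"

lemma finite_pairs: "finite W \<Longrightarrow> finite (pairs W)"
  by (simp add: pairs_def)

lemma posiform_eq_mlp_eval:
  assumes "finite W"
  shows "posiform s t W c x = mlp_eval W
    (MLP (\<Sum>i\<in>W. c i t)
      (\<lambda>i. if i \<in> W then c s i - c i t + (\<Sum>j\<in>W - {i}. c j i) else 0)
      (\<lambda>e. if e \<in> pairs W then - (\<Sum>(i, j) | i \<in> W \<and> j \<in> W \<and> i \<noteq> j \<and> {i, j} = e. c i j) else 0)) x"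
proof -
  let ?P = "SIGMA i:W. W - {i}"
  have finP: "finite ?P" using assms by auto
  have swap: "(\<Sum>i\<in>W. \<Sum>j\<in>W - {i}. c i j * x j) = (\<Sum>i\<in>W. (\<Sum>j\<in>W - {i}. c j i) * x i)"
  proof -
    have "(\<Sum>i\<in>W. \<Sum>j\<in>W - {i}. c i j * x j) = (\<Sum>(i, j)\<in>?P. c i j * x j)"
      using assms by (subst sum.Sigma) auto
    also have "\<dots> = (\<Sum>(i, j)\<in>?P. c j i * x i)"
      by (rule sum.reindex_bij_witness[where i = "\<lambda>(a, b). (b, a)" and j = "\<lambda>(a, b). (b, a)"]) auto
    also have "\<dots> = (\<Sum>i\<in>W. \<Sum>j\<in>W - {i}. c j i * x i)"
      using assms by (subst sum.Sigma) auto
    finally show ?thesis by (simp add: sum_distrib_right)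
  qed
  have quad: "(\<Sum>e\<in>pairs W. (\<Sum>(i, j) | i \<in> W \<and> j \<in> W \<and> i \<noteq> j \<and> {i, j} = e. c i j) * (\<Prod>i\<in>e. x i))
      = (\<Sum>i\<in>W. \<Sum>j\<in>W - {i}. c i j * x i * x j)"
  proof -
    have "(\<Sum>i\<in>W. \<Sum>j\<in>W - {i}. c i j * x i * x j) = (\<Sum>q\<in>?P. c (fst q) (snd q) * x (fst q) * x (snd q))"
      using assms by (subst sum.Sigma) (auto simp: case_prod_beta)
    also have "\<dots> = (\<Sum>e\<in>pairs W. \<Sum>q | q \<in> ?P \<and> {fst q, snd q} = e. c (fst q) (snd q) * x (fst q) * x (snd q))"
      by (rule sum.group[symmetric]) (use finP finite_pairs[OF assms] in \<open>auto simp: pairs_def\<close>)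
    also have "\<dots> = (\<Sum>e\<in>pairs W. (\<Sum>(i, j) | i \<in> W \<and> j \<in> W \<and> i \<noteq> j \<and> {i, j} = e. c i j) * (\<Prod>i\<in>e. x i))"
    proof (rule sum.cong[OF refl])
      fix e assume "e \<in> pairs W"
      have "(\<Sum>(i, j) | i \<in> W \<and> j \<in> W \<and> i \<noteq> j \<and> {i, j} = e. c i j) * (\<Prod>i\<in>e. x i)
          = (\<Sum>q | q \<in> ?P \<and> {fst q, snd q} = e. c (fst q) (snd q) * (\<Prod>i\<in>e. x i))"
        unfolding sum_distrib_right by (rule sum.cong) auto
      also have "\<dots> = (\<Sum>q | q \<in> ?P \<and> {fst q, snd q} = e. c (fst q) (snd q) * x (fst q) * x (snd q))"
        by (rule sum.cong) auto
      finally show "(\<Sum>q | q \<in> ?P \<and> {fst q, snd q} = e. c (fst q) (snd q) * x (fst q) * x (snd q))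
          = (\<Sum>(i, j) | i \<in> W \<and> j \<in> W \<and> i \<noteq> j \<and> {i, j} = e. c i j) * (\<Prod>i\<in>e. x i)" by simp
    qed
    finally show ?thesis by simp
  qed
  have "mlp_eval W
    (MLP (\<Sum>i\<in>W. c i t)
      (\<lambda>i. if i \<in> W then c s i - c i t + (\<Sum>j\<in>W - {i}. c j i) else 0)
      (\<lambda>e. if e \<in> pairs W then - (\<Sum>(i, j) | i \<in> W \<and> j \<in> W \<and> i \<noteq> j \<and> {i, j} = e. c i j) else 0)) x
    = (\<Sum>i\<in>W. c i t) + (\<Sum>i\<in>W. (c s i - c i t + (\<Sum>j\<in>W - {i}. c j i)) * x i)
      - (\<Sum>e\<in>pairs W. (\<Sum>(i, j) | i \<in> W \<and> j \<in> W \<and> i \<noteq> j \<and> {i, j} = e. c i j) * (\<Prod>i\<in>e. x i))"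
    by (simp add: mlp_eval_def sum_negf)
  also have "\<dots> = posiform s t W c x"
    unfolding quad posiform_def
    by (simp add: algebra_simps sum.distrib sum_subtractf swap[simplified algebra_simps])
  finally show ?thesis by simp
qed

lemma mlp_eq_if_eval_eq:
  assumes "finite W" "mlp_in W p" "mlp_in W q"
    and eq: "\<And>x. \<forall>i\<in>W. x i \<in> {0, 1} \<Longrightarrow> mlp_eval W p x = mlp_eval W q x"
  shows "p = q"
proof -
  define X :: "'a set \<Rightarrow> 'a \<Rightarrow> real" where "X A i = (if i \<in> A then 1 else 0)" for A i
  have X: "mlp_eval W r (X A) =
      mlp_const r + (\<Sum>i\<in>A. mlp_lin r i) + (\<Sum>e\<in>pairs A. mlp_quad r e)" if "A \<subseteq> W" for r A
  proof -
    have "(\<Sum>i\<in>W. mlp_lin r i * X A i) = (\<Sum>i\<in>A. mlp_lin r i)"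
      using assms(1) that by (intro sum.mono_neutral_cong_right) (auto simp: X_def)
    moreover have "(\<Sum>e\<in>pairs W. mlp_quad r e * (\<Prod>i\<in>e. X A i)) = (\<Sum>e\<in>pairs A. mlp_quad r e)"
    proof (rule sum.mono_neutral_cong_right)
      show "\<forall>e\<in>pairs W - pairs A. mlp_quad r e * (\<Prod>i\<in>e. X A i) = 0"
      proof
        fix e assume e: "e \<in> pairs W - pairs A"
        then have "finite e" "\<exists>i\<in>e. X A i = 0"
          using assms(1) by (auto simp: pairs_def X_def intro: finite_subset)
        then show "mlp_quad r e * (\<Prod>i\<in>e. X A i) = 0" by (simp add: prod_zero)
      qed
      show "mlp_quad r e * (\<Prod>i\<in>e. X A i) = mlp_quad r e" if "e \<in> pairs A" for e
        using that by (auto simp: pairs_def X_def subset_iff)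
    qed (use assms(1) that finite_pairs in \<open>auto simp: pairs_def\<close>)
    ultimately show ?thesis by (simp add: mlp_eval_def)
  qed
  have eqX: "mlp_const p + (\<Sum>i\<in>A. mlp_lin p i) + (\<Sum>e\<in>pairs A. mlp_quad p e) =
      mlp_const q + (\<Sum>i\<in>A. mlp_lin q i) + (\<Sum>e\<in>pairs A. mlp_quad q e)" if "A \<subseteq> W" for A
    using eq[of "X A"] X[OF that] by (simp add: X_def)
  have p0: "pairs {} = {}" by (auto simp: pairs_def)
  have p1: "pairs {i} = {}" for i :: 'a
    by (auto simp: pairs_def card_2_iff)
  have p2: "pairs {i, j} = {{i, j}}" if "i \<noteq> j" for i j :: 'a
    using that by (auto simp: pairs_def card_2_iff doubleton_eq_iff)
  have const: "mlp_const p = mlp_const q"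
    using eqX[of "{}"] by (simp add: p0)
  have lin: "mlp_lin p i = mlp_lin q i" for i
    using eqX[of "{i}"] assms(2,3) const by (cases "i \<in> W") (auto simp: p1 mlp_in_def)
  have "mlp_quad p e = mlp_quad q e" for e
  proof (cases "e \<in> pairs W")
    case True
    then obtain i j where "e = {i, j}" "i \<noteq> j" "e \<subseteq> W" by (auto simp: pairs_def card_2_iff)
    with eqX[of e] const lin show ?thesis by (simp add: p2)
  qed (use assms(2,3) in \<open>auto simp: mlp_in_def\<close>)
  with const lin show ?thesis by (intro mlp.expand) auto
qed

lemma ex1_mlp_of_graph:
  assumes "finite W"
  shows "\<exists>!p. mlp_in W p \<and>
    (\<forall>x. (\<forall>i\<in>W. x i \<in> {0, 1}) \<longrightarrow> mlp_eval W p x = posiform s t W c x)"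
proof (rule ex_ex1I)
  show "\<exists>p. mlp_in W p \<and>
    (\<forall>x. (\<forall>i\<in>W. x i \<in> {0, 1}) \<longrightarrow> mlp_eval W p x = posiform s t W c x)"
    by (rule exI, rule conjI[rotated], rule allI, rule impI,
        rule posiform_eq_mlp_eval[OF assms, symmetric]) (simp add: mlp_in_def)
qed (use mlp_eq_if_eval_eq[OF assms] in auto)

end

theory Submission imports Defs begin

text \<open>
  For a 0/1 labelling, extended by \<open>0\<close> at \<open>s\<close> and \<open>1\<close> at \<open>t\<close>, the posiform plus \<open>c s t\<close> is the cut
  cost \<open>\<Sum>\<^sub>u\<^sub>v c u v (1 - x u) x v\<close>, which is linear in the capacities. Pushing \<open>d\<close> along a path changes
  this cost by \<open>d \<Sum> (x u - x v)\<close> over the arcs of the path, which telescopes to \<open>-d\<close>. The cut cost of the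
  merged graph is the sum of those of the two parts, and the two updates by \<open>\<delta>\<close> together add
  \<open>\<Sum> \<delta>\<^sub>i x\<^sub>i + \<Sum> \<delta>\<^sub>i (1 - x\<^sub>i) = \<Sum> \<delta>\<^sub>i\<close>, which does not depend on the labelling.
\<close>

definition cut_cost :: "'a set \<Rightarrow> 'a capacity \<Rightarrow> ('a \<Rightarrow> real) \<Rightarrow> real" where
  "cut_cost U c x = (\<Sum>(u, v)\<in>U \<times> U. c u v * (1 - x u) * x v)"

lemma cut_cost_cong:
  assumes "\<And>u v. u \<in> U \<Longrightarrow> v \<in> U \<Longrightarrow> c u v = c' u v"
  shows "cut_cost U c x = cut_cost U c' x"
  unfolding cut_cost_def using assms by (intro sum.cong) auto

lemma cut_cost_add_arcs:
  assumes "finite U" "A \<subseteq> U \<times> U"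
  shows "cut_cost U (\<lambda>u v. c u v + (if (u, v) \<in> A then e u v else 0)) x =
    cut_cost U c x + (\<Sum>(u, v)\<in>A. e u v * (1 - x u) * x v)"
proof -
  have "(\<Sum>(u, v)\<in>A. e u v * (1 - x u) * x v) =
      (\<Sum>(u, v)\<in>U \<times> U. (if (u, v) \<in> A then e u v else 0) * (1 - x u) * x v)"
    using assms by (intro sum.mono_neutral_cong_left) auto
  then show ?thesis
    by (simp add: cut_cost_def sum.distrib[symmetric] case_prod_beta distrib_right)
qed

lemma posiform_eq_cut_cost:
  assumes "finite W" "s \<noteq> t" "s \<notin> W" "t \<notin> W" and x: "\<forall>i\<in>W. x i \<in> {0, 1}"
  shows "posiform s t W c x = cut_cost ({s, t} \<union> W) c (x(s := 0, t := 1)) - c s t"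
proof -
  define y where "y = x(s := 0, t := 1)"
  have y: "y s = 0" "y t = 1" and xy: "\<And>i. i \<in> W \<Longrightarrow> x i = y i"
    using assms by (auto simp: y_def)
  have off_diagonal: "(\<Sum>j\<in>W - {i}. c i j * (1 - y i) * y j) = (\<Sum>j\<in>W. c i j * (1 - y i) * y j)"
    if "i \<in> W" for i
    using assms(1) x xy[OF that, symmetric] that by (intro sum.mono_neutral_left) auto
  have "posiform s t W c x = posiform s t W c y"
    using xy by (simp add: posiform_def)
  also have "\<dots> = cut_cost ({s, t} \<union> W) c y - c s t"
    using assms(1-4) y unfolding posiform_def cut_cost_def sum.cartesian_product[symmetric]
    by (simp add: off_diagonal sum.distrib)
  finally show ?thesis by (simp add: y_def)
qed

lemma arcs_Cons_Cons: "arcs (a # b # p) = insert (a, b) (arcs (b # p))"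
  by (simp add: arcs_def)

lemma arcs_subset: "arcs p \<subseteq> set p \<times> set p"
  unfolding arcs_def by (cases p) (auto dest: set_zip_leftD set_zip_rightD)

lemma no_arc_into_hd:
  assumes "distinct p"
  shows "(u, hd p) \<notin> arcs p"
  using assms by (cases p) (auto simp: arcs_def dest: set_zip_rightD)

lemma sum_arcs_telescope:
  fixes f :: "'a \<Rightarrow> 'b :: ab_group_add"
  assumes "p \<noteq> []" "distinct p"
  shows "(\<Sum>(u, v)\<in>arcs p. f u - f v) = f (hd p) - f (last p)"
  using assms
proof (induction p rule: induct_list012)
  case (2 a)
  then show ?case by (simp add: arcs_def)
next
  case (3 a b p)
  have "(a, b) \<notin> arcs (b # p)" "finite (arcs (b # p))"
    using arcs_subset[of "b # p"] 3 by (auto simp: arcs_def)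
  with 3 show ?case by (simp add: arcs_Cons_Cons)
qed simp

lemma cut_cost_push:
  assumes "finite U" "set p \<subseteq> U" "p \<noteq> []" "distinct p"
  shows "cut_cost U (push c p d) x = cut_cost U c x + d * (x (hd p) - x (last p))"
proof -
  have sub: "arcs p \<subseteq> U \<times> U" "(arcs p)\<inverse> \<subseteq> U \<times> U"
    using arcs_subset[of p] assms(2) by auto
  have "push c p d = (\<lambda>u v. c u v + (if (u, v) \<in> arcs p then - d else 0)
      + (if (u, v) \<in> (arcs p)\<inverse> then d else 0))"
    by (auto simp: push_def fun_eq_iff)
  then have "cut_cost U (push c p d) x = cut_cost U c x
      + (\<Sum>(u, v)\<in>arcs p. - d * (1 - x u) * x v) + (\<Sum>(u, v)\<in>(arcs p)\<inverse>. d * (1 - x u) * x v)"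
    by (simp only: cut_cost_add_arcs[OF assms(1) sub(1)] cut_cost_add_arcs[OF assms(1) sub(2)])
  also have "(\<Sum>(u, v)\<in>(arcs p)\<inverse>. d * (1 - x u) * x v) = (\<Sum>(u, v)\<in>arcs p. d * (1 - x v) * x u)"
    by (rule sum.reindex_bij_witness[where i = prod.swap and j = prod.swap]) auto
  also have "cut_cost U c x + (\<Sum>(u, v)\<in>arcs p. - d * (1 - x u) * x v)
      + (\<Sum>(u, v)\<in>arcs p. d * (1 - x v) * x u) = cut_cost U c x + d * (\<Sum>(u, v)\<in>arcs p. x u - x v)"
    by (simp add: case_prod_beta sum_distrib_left flip: sum.distrib add.assoc) (simp add: algebra_simps)
  finally show ?thesis
    by (simp only: sum_arcs_telescope[OF assms(3,4)])
qed

lemma cut_cost_pushes: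
  assumes "pushes s t W c F c'" "finite W" "x s = 0" "x t = 1"
  shows "cut_cost ({s, t} \<union> W) c' x = cut_cost ({s, t} \<union> W) c x - F"
  using assms(1)
proof induction
  case (pushes_step F c' p d)
  then have "p \<noteq> []" "distinct p" "set p \<subseteq> {s, t} \<union> W" "hd p = s" "last p = t"
    by (auto simp: augmenting_def st_path_def)
  with pushes_step.IH assms(2-4) show ?case
    by (simp add: cut_cost_push)
qed simp

lemma pushes_source_sink_zero:
  assumes "pushes s t W c F c'" "c s t = 0"
  shows "c' s t = 0"
  using assms
proof induction
  case (pushes_step F c' p d)
  then have "(s, t) \<notin> arcs p" "(t, s) \<notin> arcs p"
    using no_arc_into_hd[of p t] by (auto simp: augmenting_def st_path_def)
  with pushes_step show ?case by (simp add: push_def)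
qed simp

lemma cut_cost_raise_source:
  assumes "finite U" "s \<in> U" "I \<subseteq> U" "x s = 0"
  shows "cut_cost U (raise_source s I \<delta> c) x = cut_cost U c x + (\<Sum>i\<in>I. \<delta> i * x i)"
proof -
  have "raise_source s I \<delta> c = (\<lambda>u v. c u v + (if (u, v) \<in> {s} \<times> I then \<delta> v else 0))"
    by (auto simp: raise_source_def fun_eq_iff)
  then have "cut_cost U (raise_source s I \<delta> c) x =
      cut_cost U c x + (\<Sum>(u, v)\<in>{s} \<times> I. \<delta> v * (1 - x u) * x v)"
    using assms(1-3) by (simp only:) (rule cut_cost_add_arcs, auto)
  with assms(4) show ?thesis by (simp flip: sum.cartesian_product)
qed

lemma cut_cost_raise_sink:
  assumes "finite U" "t \<in> U" "I \<subseteq> U" "x t = 1"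
  shows "cut_cost U (raise_sink t I \<delta> c) x = cut_cost U c x + (\<Sum>i\<in>I. \<delta> i * (1 - x i))"
proof -
  have "raise_sink t I \<delta> c = (\<lambda>u v. c u v + (if (u, v) \<in> I \<times> {t} then \<delta> u else 0))"
    by (auto simp: raise_sink_def fun_eq_iff)
  then have "cut_cost U (raise_sink t I \<delta> c) x =
      cut_cost U c x + (\<Sum>(u, v)\<in>I \<times> {t}. \<delta> u * (1 - x u) * x v)"
    using assms(1-3) by (simp only:) (rule cut_cost_add_arcs, auto)
  with assms(4) show ?thesis by (simp flip: sum.cartesian_product)
qed

definition flow_rounds ::
  "'a \<Rightarrow> 'a \<Rightarrow> 'a set \<Rightarrow> nat \<Rightarrow> (nat \<Rightarrow> 'a capacity \<Rightarrow> 'a capacity) \<Rightarrow>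
    (nat \<Rightarrow> 'a capacity) \<Rightarrow> (nat \<Rightarrow> real) \<Rightarrow> bool" where
  "flow_rounds s t W K upd c F \<longleftrightarrow>
     (\<forall>m\<in>{1..K}. \<exists>r. pushes s t W (c m) (F m) r \<and> c (m + 1) = upd m r)"

lemma cut_cost_flow_rounds:
  assumes "flow_rounds s t W K upd c F" "finite W" "x s = 0" "x t = 1"
    and upd: "\<And>m r. cut_cost ({s, t} \<union> W) (upd m r) x = cut_cost ({s, t} \<union> W) r x + g m"
  shows "cut_cost ({s, t} \<union> W) (c (K + 1)) x =
    cut_cost ({s, t} \<union> W) (c 1) x - (\<Sum>m=1..K. F m) + (\<Sum>m=1..K. g m)"
proof -
  let ?cost = "\<lambda>m. cut_cost ({s, t} \<union> W) (c m) x"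
  have round: "?cost (Suc m) - ?cost m = g m - F m" if "m \<in> {1..K}" for m
  proof -
    obtain r where "pushes s t W (c m) (F m) r" "c (Suc m) = upd m r"
      using assms(1) \<open>m \<in> {1..K}\<close> by (fastforce simp: flow_rounds_def)
    with cut_cost_pushes[of s t W "c m" "F m" r x] upd[of m r] assms(2-4) show ?thesis by simp
  qed
  have "?cost (Suc K) - ?cost 1 = (\<Sum>m=1..K. ?cost (Suc m) - ?cost m)"
    by (rule sum_Suc_diff[symmetric]) simp
  also have "\<dots> = (\<Sum>m=1..K. g m - F m)"
    by (rule sum.cong[OF refl round])
  finally show ?thesis by (simp add: sum_subtractf)
qed

lemma flow_rounds_source_sink_zero:
  assumes "flow_rounds s t W K upd c F" "\<And>m r. upd m r s t = r s t" "c 1 s t = 0"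
  shows "c (K + 1) s t = 0"
  using assms(1)
proof (induction K)
  case 0
  show ?case using assms(3) by simp
next
  case (Suc K)
  then have "c (Suc K) s t = 0" by (simp add: flow_rounds_def)
  moreover obtain r where "pushes s t W (c (Suc K)) (F (Suc K)) r" "c (Suc K + 1) = upd (Suc K) r"
    using Suc.prems by (fastforce simp: flow_rounds_def)
  ultimately show ?case by (simp add: assms(2) pushes_source_sink_zero)
qed

lemma cut_cost_merge_cap:
  assumes "finite (V1 \<union> V2)"
  shows "cut_cost ({s, t} \<union> (V1 \<union> V2)) (merge_cap s t V1 V2 c1 c2) x =
    cut_cost ({s, t} \<union> V1) c1 x + cut_cost ({s, t} \<union> V2) c2 x"
proof -
  let ?U = "{s, t} \<union> (V1 \<union> V2)"
  let ?E1 = "({s, t} \<union> V1) \<times> ({s, t} \<union> V1)" and ?E2 = "({s, t} \<union> V2) \<times> ({s, t} \<union> V2)"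
  have sub: "?E1 \<subseteq> ?U \<times> ?U" "?E2 \<subseteq> ?U \<times> ?U" and U: "finite ?U"
    using assms by auto
  have "merge_cap s t V1 V2 c1 c2 = (\<lambda>u v. 0 + (if (u, v) \<in> ?E1 then c1 u v else 0)
      + (if (u, v) \<in> ?E2 then c2 u v else 0))"
    by (auto simp: merge_cap_def fun_eq_iff)
  then have "cut_cost ?U (merge_cap s t V1 V2 c1 c2) x = cut_cost ?U (\<lambda>u v. 0) x
      + (\<Sum>(u, v)\<in>?E1. c1 u v * (1 - x u) * x v) + (\<Sum>(u, v)\<in>?E2. c2 u v * (1 - x u) * x v)"
    by (simp only: cut_cost_add_arcs[OF U sub(1)] cut_cost_add_arcs[OF U sub(2)])
  then show ?thesis by (simp add: cut_cost_def)
qed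

lemma merge_split_cap:
  assumes
    "\<forall>i\<in>V1 \<union> V2. \<forall>j\<in>V1 \<union> V2. c i j \<noteq> 0 \<longrightarrow> i \<in> V1 \<and> j \<in> V1 \<or> i \<in> V2 \<and> j \<in> V2"
    and "u \<in> {s, t} \<union> (V1 \<union> V2)" "v \<in> {s, t} \<union> (V1 \<union> V2)"
  shows "merge_cap s t V1 V2 (split_cap s t (V1 \<inter> V2) V1 c) (split_cap s t (V1 \<inter> V2) V2 c) u v =
    c u v"
  using assms unfolding merge_cap_def split_cap_def by auto

lemma cut_cost_merge_flow_rounds:
  assumes "finite (V1 \<union> V2)" "x s = 0" "x t = 1"
    and "flow_rounds s t V1 K (\<lambda>m. raise_source s (V1 \<inter> V2) (\<delta> m)) c1 F1"
    and "flow_rounds s t V2 K (\<lambda>m. raise_sink t (V1 \<inter> V2) (\<delta> m)) c2 F2"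
  shows "cut_cost ({s, t} \<union> (V1 \<union> V2)) (merge_cap s t V1 V2 (c1 (K + 1)) (c2 (K + 1))) x =
    cut_cost ({s, t} \<union> (V1 \<union> V2)) (merge_cap s t V1 V2 (c1 1) (c2 1)) x
    - (\<Sum>m=1..K. F1 m) - (\<Sum>m=1..K. F2 m) + (\<Sum>m=1..K. \<Sum>i\<in>V1 \<inter> V2. \<delta> m i)"
proof -
  let ?I = "V1 \<inter> V2"
  have fin: "finite V1" "finite V2" using assms(1) by auto
  have "cut_cost ({s, t} \<union> V1) (c1 (K + 1)) x = cut_cost ({s, t} \<union> V1) (c1 1) x
      - (\<Sum>m=1..K. F1 m) + (\<Sum>m=1..K. \<Sum>i\<in>?I. \<delta> m i * x i)"
    using fin assms(2)
    by (intro cut_cost_flow_rounds[OF assms(4) fin(1) assms(2,3)] cut_cost_raise_source) auto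
  moreover have "cut_cost ({s, t} \<union> V2) (c2 (K + 1)) x = cut_cost ({s, t} \<union> V2) (c2 1) x
      - (\<Sum>m=1..K. F2 m) + (\<Sum>m=1..K. \<Sum>i\<in>?I. \<delta> m i * (1 - x i))"
    using fin assms(3)
    by (intro cut_cost_flow_rounds[OF assms(5) fin(2) assms(2,3)] cut_cost_raise_sink) auto
  moreover have "(\<Sum>m=1..K. \<Sum>i\<in>?I. \<delta> m i * x i) + (\<Sum>m=1..K. \<Sum>i\<in>?I. \<delta> m i * (1 - x i)) =
      (\<Sum>m=1..K. \<Sum>i\<in>?I. \<delta> m i)"
    by (simp add: right_diff_distrib flip: sum.distrib)
  ultimately show ?thesis
    unfolding cut_cost_merge_cap[OF assms(1)] by linarith
qed

lemma posiform_merge_flow_rounds: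
  assumes "finite (V1 \<union> V2)" "s \<noteq> t" "s \<notin> V1 \<union> V2" "t \<notin> V1 \<union> V2"
    and x: "\<forall>i\<in>V1 \<union> V2. x i \<in> {0, 1}"
    and arcs_within:
      "\<forall>i\<in>V1 \<union> V2. \<forall>j\<in>V1 \<union> V2. c i j \<noteq> 0 \<longrightarrow> i \<in> V1 \<and> j \<in> V1 \<or> i \<in> V2 \<and> j \<in> V2"
    and start: "c1 1 = split_cap s t (V1 \<inter> V2) V1 c" "c2 1 = split_cap s t (V1 \<inter> V2) V2 c"
    and rounds: "flow_rounds s t V1 K (\<lambda>m. raise_source s (V1 \<inter> V2) (\<delta> m)) c1 F1"
      "flow_rounds s t V2 K (\<lambda>m. raise_sink t (V1 \<inter> V2) (\<delta> m)) c2 F2"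
  defines "c' \<equiv> merge_cap s t V1 V2 (c1 (K + 1)) (c2 (K + 1))"
  shows "posiform s t (V1 \<union> V2) c x = posiform s t (V1 \<union> V2) c' x
    + (\<Sum>m=1..K. F1 m) + (\<Sum>m=1..K. F2 m) - (\<Sum>m=1..K. \<Sum>i\<in>V1 \<inter> V2. \<delta> m i) - (c s t - c' s t)"
proof -
  let ?U = "{s, t} \<union> (V1 \<union> V2)" and ?y = "x(s := 0, t := 1)"
  have "cut_cost ?U c ?y = cut_cost ?U (merge_cap s t V1 V2 (c1 1) (c2 1)) ?y"
    unfolding start by (intro cut_cost_cong merge_split_cap[OF arcs_within, symmetric])
  moreover have "cut_cost ?U c' ?y = cut_cost ?U (merge_cap s t V1 V2 (c1 1) (c2 1)) ?y
      - (\<Sum>m=1..K. F1 m) - (\<Sum>m=1..K. F2 m) + (\<Sum>m=1..K. \<Sum>i\<in>V1 \<inter> V2. \<delta> m i)"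
    unfolding c'_def using assms(1,2) by (intro cut_cost_merge_flow_rounds[OF _ _ _ rounds]) auto
  ultimately show ?thesis
    unfolding posiform_eq_cut_cost[OF assms(1-4) x] by linarith
qed

lemma mlp_in_mlp_of_graph:
  assumes "finite W"
  shows "mlp_in W (mlp_of_graph s t W c)"
  using theI'[OF ex1_mlp_of_graph[OF assms, of s t c]] by (simp add: mlp_of_graph_def)

lemma mlp_eval_mlp_of_graph:
  assumes "finite W" "\<forall>i\<in>W. x i \<in> {0, 1}"
  shows "mlp_eval W (mlp_of_graph s t W c) x = posiform s t W c x"
  using theI'[OF ex1_mlp_of_graph[OF assms(1), of s t c]] assms(2) by (simp add: mlp_of_graph_def)

lemma mlp_of_graph_posiform_shift:
  assumes "finite W"
    and shift: "\<And>x. \<forall>i\<in>W. x i \<in> {0, 1} \<Longrightarrow> posiform s t W c x = posiform s t W c' x + D"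
  shows "mlp_eval W (mlp_of_graph s t W c) x = mlp_eval W (mlp_of_graph s t W c') x + D"
    and "mlp_lin (mlp_of_graph s t W c) = mlp_lin (mlp_of_graph s t W c')"
    and "mlp_quad (mlp_of_graph s t W c) = mlp_quad (mlp_of_graph s t W c')"
proof -
  let ?p = "mlp_of_graph s t W c'"
  let ?q = "MLP (mlp_const ?p + D) (mlp_lin ?p) (mlp_quad ?p)"
  have eval_q: "mlp_eval W ?q y = mlp_eval W ?p y + D" for y
    by (simp add: mlp_eval_def)
  have "mlp_of_graph s t W c = ?q"
  proof (rule mlp_eq_if_eval_eq[OF assms(1) mlp_in_mlp_of_graph[OF assms(1)]])
    show "mlp_in W ?q"
      using mlp_in_mlp_of_graph[OF assms(1), of s t c'] by (simp add: mlp_in_def)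
    show "mlp_eval W (mlp_of_graph s t W c) y = mlp_eval W ?q y" if "\<forall>i\<in>W. y i \<in> {0, 1}" for y
      by (simp only: eval_q mlp_eval_mlp_of_graph[OF assms(1) that] shift[OF that])
  qed
  then show "mlp_eval W (mlp_of_graph s t W c) x = mlp_eval W ?p x + D"
    and "mlp_lin (mlp_of_graph s t W c) = mlp_lin ?p"
    and "mlp_quad (mlp_of_graph s t W c) = mlp_quad ?p"
    by (simp_all add: eval_q)
qed

theorem theorem2:
  fixes s t :: 'a
    and V V1 V2 :: "'a set"
    and c c' :: "'a capacity"
    and c1 c2 r1 r2 :: "nat \<Rightarrow> 'a capacity"
    and F1 F2 :: "nat \<Rightarrow> real"
    and lam :: "nat \<Rightarrow> 'a \<Rightarrow> real"
    and K :: nat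
  assumes "finite V" and "s \<noteq> t" and "s \<notin> V" and "t \<notin> V"
    and "\<forall>u\<in>{s, t} \<union> V. \<forall>v\<in>{s, t} \<union> V. 0 \<le> c u v"
    and "V1 \<union> V2 = V" and "V1 \<inter> V2 \<noteq> {}"
    and "\<forall>i\<in>V. \<forall>j\<in>V. 0 < c i j \<longrightarrow> i \<in> V1 \<and> j \<in> V1 \<or> i \<in> V2 \<and> j \<in> V2"
    and "1 \<le> K"
    and "c1 1 = split_cap s t (V1 \<inter> V2) V1 c"
    and "c2 1 = split_cap s t (V1 \<inter> V2) V2 c"
    and "\<forall>m\<in>{1..K}. maxflow_run s t V1 (c1 m) (F1 m) (r1 m)"
    and "\<forall>m\<in>{1..K}. maxflow_run s t V2 (c2 m) (F2 m) (r2 m)"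
    and "\<forall>m\<in>{1..K}. c1 (m + 1) =
           raise_source s (V1 \<inter> V2) (\<lambda>i. lam (m + 1) i - lam m i) (r1 m)"
    and "\<forall>m\<in>{1..K}. c2 (m + 1) =
           raise_sink t (V1 \<inter> V2) (\<lambda>i. lam (m + 1) i - lam m i) (r2 m)"
    and "c' = merge_cap s t V1 V2 (c1 (K + 1)) (c2 (K + 1))"
  shows "(\<forall>x. mlp_eval V (mlp_of_graph s t V c) x =
            mlp_eval V (mlp_of_graph s t V c') x + (\<Sum>m=1..K. F1 m) + (\<Sum>m=1..K. F2 m)
            - (\<Sum>i\<in>V1 \<inter> V2. lam (K + 1) i - lam 1 i) - (c s t - c' s t))
       \<and> mlp_lin (mlp_of_graph s t V c) = mlp_lin (mlp_of_graph s t V c')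
       \<and> mlp_quad (mlp_of_graph s t V c) = mlp_quad (mlp_of_graph s t V c')
       \<and> (c s t = 0 \<and> (\<Sum>i\<in>V1 \<inter> V2. lam (K + 1) i) = (\<Sum>i\<in>V1 \<inter> V2. lam 1 i) \<longrightarrow>
           (\<forall>x. mlp_eval V (mlp_of_graph s t V c) x =
              mlp_eval V (mlp_of_graph s t V c') x + (\<Sum>m=1..K. F1 m) + (\<Sum>m=1..K. F2 m)))"
proof -
  let ?I = "V1 \<inter> V2" and ?\<delta> = "\<lambda>m i. lam (m + 1) i - lam m i"
  let ?D = "(\<Sum>m=1..K. F1 m) + (\<Sum>m=1..K. F2 m)
    - (\<Sum>i\<in>?I. lam (K + 1) i - lam 1 i) - (c s t - c' s t)"
  have rounds1: "flow_rounds s t V1 K (\<lambda>m. raise_source s ?I (?\<delta> m)) c1 F1"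
    and rounds2: "flow_rounds s t V2 K (\<lambda>m. raise_sink t ?I (?\<delta> m)) c2 F2"
    using assms(12-15) by (auto simp: flow_rounds_def maxflow_run_def)
  have "(\<Sum>m=1..K. ?\<delta> m i) = lam (K + 1) i - lam 1 i" for i
    using sum_Suc_diff[of 1 K "\<lambda>m. lam m i"] by simp
  then have dual_sum: "(\<Sum>m=1..K. \<Sum>i\<in>?I. ?\<delta> m i) = (\<Sum>i\<in>?I. lam (K + 1) i - lam 1 i)"
    by (subst sum.swap) simp
  have arcs_within: "\<forall>i\<in>V1 \<union> V2. \<forall>j\<in>V1 \<union> V2. c i j \<noteq> 0 \<longrightarrow> i \<in> V1 \<and> j \<in> V1 \<or> i \<in> V2 \<and> j \<in> V2"
    using assms(5,6,8) by (metis UnCI order_less_le)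
  have "posiform s t V c x = posiform s t V c' x + ?D" if "\<forall>i\<in>V. x i \<in> {0, 1}" for x
    using posiform_merge_flow_rounds[OF _ assms(2) _ _ _ arcs_within assms(10,11) rounds1 rounds2]
      assms(1,3,4) that
    unfolding assms(6) assms(16)[symmetric] dual_sum by simp
  note shift = mlp_of_graph_posiform_shift[OF assms(1) this]
  have "c' s t = 0" if "c s t = 0"
    using flow_rounds_source_sink_zero[OF rounds1] flow_rounds_source_sink_zero[OF rounds2]
      assms(3,4,6,10,11,16) that
    by (auto simp: raise_source_def raise_sink_def split_cap_def merge_cap_def)
  with shift show ?thesis by (simp add: sum_subtractf)
qed

end
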